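(* Fix $d\ge 3$, $c>0$, $\frac{d-1}{d+1}<\delta<1$, let $p=(c+o_n(1))n^{-d+1+\delta}$ and let $\mathcal{H}$ be the random $d$-uniform hypergraph on $[n]$ with each $d$-subset a hyperedge independently with probability $p$. Then the weighted partial recovery loss is $1-o_n(1)$.
   Context: $\mathrm{Proj}_W(H)$ is the weighted graph on $[n]$ where $\{i,j\}$ has weight equal to the number of hyperedges containing it. The weighted partial recovery loss is $\min_{\mathcal{B}_W}\mathbb{E}[|\mathcal{B}_W(\mathrm{Proj}_W(\mathcal{H}))\Delta E(\mathcal{H})|]/(p\binom nd)$ over all functions $\mathcal{B}_W$ from weighted projections to sets of $d$-subsets of $[n]$. *)

theory Defs
  imports "HOL-Probability.Probability"
begin

definition d_subsets :: "nat \<Rightarrow> nat \<Rightarrow> nat set set" where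
  "d_subsets n d = {e. e \<subseteq> {1..n} \<and> card e = d}"

text \<open>
  A \<open>d\<close>-uniform hypergraph on \<open>{1..n}\<close> is identified with its set of hyperedges.
  Values of \<open>p\<close> outside the unit interval are truncated by \<^const>\<open>bernoulli_pmf\<close>.
\<close>

definition random_hypergraph :: "nat \<Rightarrow> nat \<Rightarrow> real \<Rightarrow> nat set set pmf" where
  "random_hypergraph n d p =
     map_pmf (\<lambda>f. {e \<in> d_subsets n d. f e})
       (Pi_pmf (d_subsets n d) False (\<lambda>_. bernoulli_pmf p))"

text \<open>
  A weighted graph is a weight function on unordered pairs, extended by 0 to all other sets.
  Pairs not contained in \<open>{1..n}\<close> automatically get weight 0 if \<open>H \<subseteq> d_subsets n d\<close>.
\<close>

definition weighted_proj :: "nat set set \<Rightarrow> nat set \<Rightarrow> nat" where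
  "weighted_proj H = (\<lambda>e. if card e = 2 then card {h \<in> H. e \<subseteq> h} else 0)"

definition weighted_projections :: "nat \<Rightarrow> nat \<Rightarrow> (nat set \<Rightarrow> nat) set" where
  "weighted_projections n d = weighted_proj ` Pow (d_subsets n d)"

text \<open>
  Estimators are taken in the extensional function space, so that there are only finitely many
  of them and the minimum below is attained; the values of an estimator outside of
  \<open>weighted_projections n d\<close> are irrelevant.
\<close>

definition estimators :: "nat \<Rightarrow> nat \<Rightarrow> ((nat set \<Rightarrow> nat) \<Rightarrow> nat set set) set" where
  "estimators n d = weighted_projections n d \<rightarrow>\<^sub>E Pow (d_subsets n d)"

definition weighted_partial_recovery_loss :: "nat \<Rightarrow> nat \<Rightarrow> real \<Rightarrow> real" where
  "weighted_partial_recovery_loss n d p =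
     Min ((\<lambda>B. measure_pmf.expectation (random_hypergraph n d p)
                  (\<lambda>H. real (card (sym_diff (B (weighted_proj H)) H)))
                / (p * real (n choose d))) ` estimators n d)"

lemma finite_d_subsets: "finite (d_subsets n d)"
  unfolding d_subsets_def by simp

lemma finite_estimators: "finite (estimators n d)"
  unfolding estimators_def weighted_projections_def
  by (intro finite_PiE) (simp_all add: finite_d_subsets)

lemma estimators_nonempty: "estimators n d \<noteq> {}"
  unfolding estimators_def by (auto simp: PiE_eq_empty_iff)

end

theory Submission
  imports Defs "HOL-Real_Asymp.Real_Asymp"
begin

text \<open>
  An estimator that does better than the empty set would give too short a description of the
  hypergraph. Describe \<open>H\<close> by first encoding its weighted projection, with independent geometric
  weights of parameter \<open>\<rho> = n\<^sup>\<delta>\<^sup>-\<^sup>1\<close>, and then \<open>H\<close> itself, with one bit for each \<open>e\<close> in the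
  estimate and with inclusion probability \<open>\<tau> = n\<^sup>-\<^sup>\<eta>\<close> for each other clique of the projection.
  With \<open>m = p (n choose d)\<close> and loss \<open>L\<close>, the two parts cost at most
  \<open>m (d choose 2) (1 - \<delta>) ln n + O(m)\<close> and \<open>m L \<eta> ln n + O(m)\<close>, provided that \<open>\<tau>\<close> times the
  expected number of cliques is \<open>O(m)\<close>. The entropy of \<open>H\<close> is at least
  \<open>m (d - 1 - \<delta>) ln n - O(m)\<close>. For \<open>\<eta> = d - 1 - \<delta> - (d choose 2) (1 - \<delta>)\<close>, which is positive
  precisely above the threshold, this yields \<open>L \<ge> 1 - O(1 / ln n)\<close>. The clique count is a union
  bound over the ways to cover the pairs of a \<open>d\<close>-set \<open>e\<close> by traces \<open>h \<inter> e\<close> of hyperedges; above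
  the threshold, covering the pairs one by one is the cheapest way.
\<close>

section \<open>Gibbs' inequality\<close>

text \<open>Follows from \<open>ln y \<le> y - 1\<close> at the ratio \<open>m x / pmf P x\<close>.
  Total mass at most 1 suffices, so \<open>m\<close> may be a defective description of the
  outcome.\<close>

lemma expectation_ln_le_expectation_ln_pmf:
  fixes P :: "'a pmf" and m :: "'a \<Rightarrow> real"
  assumes fin: "finite (set_pmf P)"
    and pos: "\<And>x. x \<in> set_pmf P \<Longrightarrow> m x > 0"
    and sum: "(\<Sum>x\<in>set_pmf P. m x) \<le> 1"
  shows "measure_pmf.expectation P (\<lambda>x. ln (m x)) \<le> measure_pmf.expectation P (\<lambda>x. ln (pmf P x))"
proof -
  have "(\<Sum>x\<in>set_pmf P. pmf P x * ln (m x)) - (\<Sum>x\<in>set_pmf P. pmf P x * ln (pmf P x))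
      = (\<Sum>x\<in>set_pmf P. pmf P x * ln (m x / pmf P x))"
    unfolding sum_subtractf[symmetric]
    by (intro sum.cong refl)
      (simp add: pos[THEN less_imp_neq[THEN not_sym]] ln_div right_diff_distrib set_pmf_iff)
  also have "\<dots> \<le> (\<Sum>x\<in>set_pmf P. pmf P x * (m x / pmf P x - 1))"
    by (intro sum_mono mult_left_mono ln_le_minus_one) (auto simp: pos pmf_positive)
  also have "\<dots> = (\<Sum>x\<in>set_pmf P. m x) - (\<Sum>x\<in>set_pmf P. pmf P x)"
    unfolding sum_subtractf[symmetric]
    by (intro sum.cong refl) (auto simp: set_pmf_iff right_diff_distrib)
  also have "\<dots> \<le> 0"
    using sum sum_pmf_eq_1[OF fin order_refl] by simp
  finally show ?thesis
    by (simp add: integral_measure_pmf[OF fin])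
qed

section \<open>Random subsets with independent inclusions\<close>

text \<open>The probability may vary with the element: the constant case is the random hypergraph,
  the varying case describes a hypergraph once its projection is known.\<close>

definition random_subset :: "'a set \<Rightarrow> ('a \<Rightarrow> real) \<Rightarrow> 'a set pmf" where
  "random_subset D s = map_pmf (\<lambda>f. {e \<in> D. f e}) (Pi_pmf D False (\<lambda>e. bernoulli_pmf (s e)))"

lemma random_hypergraph_eq_random_subset:
  "random_hypergraph n d p = random_subset (d_subsets n d) (\<lambda>_. p)"
  by (simp add: random_hypergraph_def random_subset_def)

lemma set_pmf_random_subset: "set_pmf (random_subset D s) \<subseteq> Pow D"
  by (auto simp: random_subset_def)

lemma finite_set_pmf_random_subset: "finite D \<Longrightarrow> finite (set_pmf (random_subset D s))"
  by (rule finite_subset[OF set_pmf_random_subset]) simp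

text \<open>Unlike restriction to \<open>D\<close>, \<open>Collect\<close> is injective on all
  predicates, so point masses carry over directly.\<close>

lemma random_subset_eq_map_Collect:
  assumes "finite D"
  shows "random_subset D s = map_pmf Collect (Pi_pmf D False (\<lambda>e. bernoulli_pmf (s e)))"
  unfolding random_subset_def
proof (intro map_pmf_cong refl)
  fix f assume "f \<in> set_pmf (Pi_pmf D False (\<lambda>e. bernoulli_pmf (s e)))"
  then have "\<forall>e. e \<notin> D \<longrightarrow> \<not> f e"
    using set_Pi_pmf_subset[OF assms, of False "\<lambda>e. bernoulli_pmf (s e)"] by auto
  then show "{e \<in> D. f e} = Collect f" by blast
qed

lemma pmf_random_subset:
  assumes "finite D" "H \<subseteq> D" "\<And>e. e \<in> D \<Longrightarrow> 0 \<le> s e \<and> s e \<le> 1"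
  shows "pmf (random_subset D s) H = (\<Prod>e\<in>D. if e \<in> H then s e else 1 - s e)"
proof -
  have "pmf (random_subset D s) (Collect (\<lambda>e. e \<in> H))
      = pmf (Pi_pmf D False (\<lambda>e. bernoulli_pmf (s e))) (\<lambda>e. e \<in> H)"
    unfolding random_subset_eq_map_Collect[OF assms(1)]
    by (rule pmf_map_inj') (auto simp: inj_on_def)
  also have "\<dots> = (\<Prod>e\<in>D. pmf (bernoulli_pmf (s e)) (e \<in> H))"
    by (rule pmf_Pi') (use assms in auto)
  also have "\<dots> = (\<Prod>e\<in>D. if e \<in> H then s e else 1 - s e)"
    using assms(3) by (intro prod.cong refl) auto
  finally show ?thesis by simp
qed

lemma expectation_random_subset_prod:
  assumes D: "finite D" "G \<subseteq> D" and p: "0 \<le> p" "p \<le> 1"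
  shows "measure_pmf.expectation (random_subset D (\<lambda>_. p)) (\<lambda>H. of_bool (G \<subseteq> H)) = p ^ card G"
proof -
  let ?M = "Pi_pmf D False (\<lambda>e. bernoulli_pmf p)"
  have "measure_pmf.expectation (random_subset D (\<lambda>_. p)) (\<lambda>H. of_bool (G \<subseteq> H) :: real)
      = measure_pmf.expectation ?M (indicator (Pi D (\<lambda>e. if e \<in> G then {True} else UNIV)))"
    unfolding random_subset_def integral_map_pmf
    by (intro Bochner_Integration.integral_cong refl)
      (use D in \<open>auto simp: indicator_def Pi_def\<close>)
  also have "\<dots> = measure_pmf.prob ?M (Pi D (\<lambda>e. if e \<in> G then {True} else UNIV))"
    by simp
  also have "\<dots> = (\<Prod>e\<in>D. measure_pmf.prob (bernoulli_pmf p) (if e \<in> G then {True} else UNIV))"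
    by (rule measure_Pi_pmf_Pi[OF D(1)])
  also have "\<dots> = (\<Prod>e\<in>D. if e \<in> G then p else 1)"
    using p by (intro prod.cong refl) (auto simp: measure_pmf_single)
  also have "\<dots> = p ^ card G"
    using D by (simp add: prod.If_cases Int_absorb1)
  finally show ?thesis .
qed

lemma integrable_random_subset [simp]:
  "finite D \<Longrightarrow> integrable (measure_pmf (random_subset D s)) (f :: _ \<Rightarrow> real)"
  by (rule integrable_measure_pmf_finite) (rule finite_set_pmf_random_subset)

text \<open>The product of counts expands into a sum over choices \<open>g\<close> of one element
  from each \<open>A S\<close>. Disjointness makes the chosen elements distinct, so each choice
  contributes exactly \<open>p ^ card F\<close>.\<close>

lemma expectation_random_subset_prod_card:
  assumes D: "finite D" and p: "0 \<le> p" "p \<le> 1" and F: "finite F"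
    and A: "\<And>S. S \<in> F \<Longrightarrow> A S \<subseteq> D" and disj: "disjoint_family_on A F"
  shows "measure_pmf.expectation (random_subset D (\<lambda>_. p)) (\<lambda>H. \<Prod>S\<in>F. real (card (H \<inter> A S)))
       = (\<Prod>S\<in>F. p * real (card (A S)))"
proof -
  have finA: "finite (A S)" if "S \<in> F" for S
    using A[OF that] D finite_subset by blast
  have "(\<Prod>S\<in>F. real (card (H \<inter> A S))) = (\<Sum>g\<in>PiE F A. of_bool (g ` F \<subseteq> H))" for H
  proof -
    have "(\<Prod>S\<in>F. real (card (H \<inter> A S))) = (\<Prod>S\<in>F. \<Sum>h\<in>A S. of_bool (h \<in> H))"
      by (intro prod.cong refl) (simp add: finA sum.If_cases of_bool_def Int_commute)
    also have "\<dots> = (\<Sum>g\<in>PiE F A. \<Prod>S\<in>F. of_bool (g S \<in> H))"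
      by (rule prod_sum_PiE) (use F finA in auto)
    also have "\<dots> = (\<Sum>g\<in>PiE F A. of_bool (g ` F \<subseteq> H))"
      using F by (intro sum.cong refl) (auto simp: image_subset_iff intro!: prod.neutral)
    finally show ?thesis .
  qed
  then have "measure_pmf.expectation (random_subset D (\<lambda>_. p)) (\<lambda>H. \<Prod>S\<in>F. real (card (H \<inter> A S)))
     = (\<Sum>g\<in>PiE F A. measure_pmf.expectation (random_subset D (\<lambda>_. p)) (\<lambda>H. of_bool (g ` F \<subseteq> H)))"
    using D by (simp add: Bochner_Integration.integral_sum)
  also have "\<dots> = (\<Sum>g\<in>PiE F A. p ^ card F)"
  proof (intro sum.cong refl)
    fix g assume g: "g \<in> PiE F A"
    have "inj_on g F"
      using g disj by (fastforce simp: inj_on_def disjoint_family_on_def PiE_iff)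
    moreover have "g ` F \<subseteq> D"
      using g A by (auto simp: PiE_iff)
    ultimately show "measure_pmf.expectation (random_subset D (\<lambda>_. p)) (\<lambda>H. of_bool (g ` F \<subseteq> H)) = p ^ card F"
      using expectation_random_subset_prod[OF D _ p] by (metis card_image)
  qed
  also have "\<dots> = (\<Prod>S\<in>F. p * real (card (A S)))"
    using F finA by (simp add: card_PiE prod.distrib mult.commute)
  finally show ?thesis .
qed

lemma expectation_card_random_subset:
  assumes "finite D" "0 \<le> p" "p \<le> 1"
  shows "measure_pmf.expectation (random_subset D (\<lambda>_. p)) (\<lambda>H. real (card H)) = p * real (card D)"
proof -
  have "measure_pmf.expectation (random_subset D (\<lambda>_. p)) (\<lambda>H. real (card H))
      = measure_pmf.expectation (random_subset D (\<lambda>_. p)) (\<lambda>H. \<Prod>S\<in>{()}. real (card (H \<inter> D)))"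
    by (intro integral_cong_AE AE_pmfI)
      (use set_pmf_random_subset[of D "\<lambda>_. p"] in \<open>auto simp: Int_absorb2 subset_eq\<close>)
  also have "\<dots> = p * real (card D)"
    by (subst expectation_random_subset_prod_card) (use assms in \<open>auto simp: disjoint_family_on_def\<close>)
  finally show ?thesis .
qed

section \<open>Weighted projections and their cliques\<close>

lemma card_d_subsets: "card (d_subsets n d) = n choose d"
  unfolding d_subsets_def by (subst n_subsets) auto

lemma weighted_proj_eq_0:
  assumes "H \<subseteq> d_subsets n d" "u \<notin> d_subsets n 2"
  shows "weighted_proj H u = 0"
proof -
  have empty: "{h \<in> H. u \<subseteq> h} = {}" if "card u = 2"
    using assms that unfolding d_subsets_def by blast
  show ?thesis by (cases "card u = 2") (simp_all add: weighted_proj_def empty)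
qed

text \<open>Double counting of pairs inside hyperedges. It makes the cost of encoding the weights
  linear in \<open>card H\<close>.\<close>

lemma sum_weighted_proj:
  assumes "H \<subseteq> d_subsets n d"
  shows "(\<Sum>u\<in>d_subsets n 2. weighted_proj H u) = (d choose 2) * card H"
proof -
  have fin: "finite H"
    using assms finite_d_subsets finite_subset by blast
  have "(\<Sum>u\<in>d_subsets n 2. weighted_proj H u) = (\<Sum>u\<in>d_subsets n 2. \<Sum>h\<in>H. of_bool (u \<subseteq> h))"
    using fin by (intro sum.cong refl)
      (simp add: weighted_proj_def d_subsets_def of_bool_def sum.If_cases Int_def)
  also have "\<dots> = (\<Sum>h\<in>H. \<Sum>u\<in>d_subsets n 2. of_bool (u \<subseteq> h))"
    by (rule sum.swap)
  also have "\<dots> = (\<Sum>h\<in>H. d choose 2)"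
  proof (intro sum.cong refl)
    fix h assume "h \<in> H"
    then have h: "h \<subseteq> {1..n}" "card h = d"
      using assms by (auto simp: d_subsets_def)
    then have fin_h: "finite h"
      using finite_subset by blast
    have "(\<Sum>u\<in>d_subsets n 2. of_bool (u \<subseteq> h)) = card (d_subsets n 2 \<inter> {u. u \<subseteq> h})"
      by (simp add: finite_d_subsets of_bool_def sum.If_cases)
    also have "d_subsets n 2 \<inter> {u. u \<subseteq> h} = {u. u \<subseteq> h \<and> card u = 2}"
      using h by (auto simp: d_subsets_def)
    finally show "(\<Sum>u\<in>d_subsets n 2. of_bool (u \<subseteq> h)) = d choose 2"
      using n_subsets[OF fin_h, of 2] h by simp
  qed
  finally show ?thesis by simp
qed

definition weighted_cliques :: "nat \<Rightarrow> nat \<Rightarrow> (nat set \<Rightarrow> nat) \<Rightarrow> nat set set" where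
  "weighted_cliques n d w = {e \<in> d_subsets n d. \<forall>u\<subseteq>e. card u = 2 \<longrightarrow> 0 < w u}"

text \<open>Every pair inside a hyperedge is counted by that hyperedge. Hence a description may give
  non-cliques probability 0 without excluding \<open>H\<close>.\<close>

lemma hypergraph_subset_weighted_cliques:
  assumes "H \<subseteq> d_subsets n d"
  shows "H \<subseteq> weighted_cliques n d (weighted_proj H)"
proof -
  have "finite H" using assms finite_d_subsets finite_subset by blast
  then show ?thesis
    using assms by (auto simp: weighted_cliques_def weighted_proj_def card_gt_0_iff)
qed

section \<open>The information inequality\<close>

lemma sum_pmf_le_1: "finite S \<Longrightarrow> (\<Sum>x\<in>S. pmf P x) \<le> 1"
  by (metis measure_measure_pmf_finite measure_pmf.prob_le_1)

lemma ln_one_minus_ge: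
  fixes x :: real
  assumes "0 \<le> x" "x \<le> 1/2"
  shows "- (2 * x) \<le> ln (1 - x)"
proof -
  have "x * x \<le> x * (1/2)"
    using assms by (intro mult_left_mono)
  then have "- (2 * x) \<le> - x - 2 * x\<^sup>2"
    by (simp add: power2_eq_square)
  also have "\<dots> \<le> ln (1 - x)"
    using ln_one_minus_pos_lower_bound assms by blast
  finally show ?thesis .
qed

text \<open>The left side bounds the entropy from below. The terms on the right pay, in order, for
  the normalisation of the geometric weights, the weights themselves, the bits on the estimate, the
  hyperedges that the estimate misses, and the absent cliques.\<close>

lemma information_bound:
  fixes n d :: nat and p \<rho> \<tau> :: real
  assumes p: "0 < p" "p < 1" and \<rho>: "0 < \<rho>" "\<rho> < 1" and \<tau>: "0 < \<tau>" "\<tau> \<le> 1/2"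
    and B: "B \<in> estimators n d"
  defines "E \<equiv> measure_pmf.expectation (random_hypergraph n d p)"
  shows "p * real (n choose d) * ln (1/p)
     \<le> real (n choose 2) * ln (1/(1-\<rho>)) + real (d choose 2) * ln (1/\<rho>) * (p * real (n choose d))
       + ln 2 * E (\<lambda>H. real (card (B (weighted_proj H))))
       + ln (1/\<tau>) * E (\<lambda>H. real (card (H - B (weighted_proj H))))
       + 2 * \<tau> * E (\<lambda>H. real (card (weighted_cliques n d (weighted_proj H))))"
proof -
  define D where "D = d_subsets n d"
  define P where "P = random_hypergraph n d p"
  let ?W = weighted_proj
  let ?C = "weighted_cliques n d"
  \<comment> \<open>Probability 1/2 costs \<open>ln 2\<close> whether or not \<open>e\<close> is
    present; \<open>\<tau>\<close> costs \<open>ln (1/\<tau>)\<close> if \<open>e\<close> is present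
    and at most \<open>2 * \<tau>\<close> if absent; 0 is free, as no hyperedge lies there.\<close>
  define s where "s w e = (if e \<in> B w then 1/2 else if e \<in> ?C w then \<tau> else 0)" for w e
  \<comment> \<open>\<open>geometric_pmf (1-\<rho>)\<close> gives weight \<open>k\<close> the mass
    \<open>\<rho> ^ k * (1-\<rho>)\<close>. The default 0 agrees with the weight of sets that are
    not pairs in \<open>{1..n}\<close>.\<close>
  define R where "R = pmf (Pi_pmf (d_subsets n 2) 0 (\<lambda>_. geometric_pmf (1-\<rho>)))"
  define Q where "Q w = pmf (random_subset D (s w))" for w
  text \<open>\<open>m\<close> describes \<open>H\<close> by its projection, drawn with independent geometric weights, and then by
    independent edges guided by the estimate. It has total mass at most 1, so Gibbs' inequality
    compares it with \<open>P\<close>.\<close>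
  define m where "m H = R (?W H) * Q (?W H) H" for H
  have finD: "finite D" and P: "P = random_subset D (\<lambda>_. p)"
    by (simp_all add: D_def finite_d_subsets P_def random_hypergraph_eq_random_subset)
  have finP: "finite (set_pmf P)" and subP: "set_pmf P \<subseteq> Pow D"
    unfolding P by (rule finite_set_pmf_random_subset[OF finD], rule set_pmf_random_subset)
  have s01: "0 \<le> s w e \<and> s w e \<le> 1" for w e
    using \<tau> by (auto simp: s_def)
  have BD: "B (?W H) \<subseteq> D" if "H \<subseteq> D" for H
    using B that by (auto simp: estimators_def weighted_projections_def D_def)
  have CD: "?C w \<subseteq> D" for w
    by (auto simp: weighted_cliques_def D_def)
  have HC: "H \<subseteq> ?C (?W H)" if "H \<subseteq> D" for H
    using hypergraph_subset_weighted_cliques that by (simp add: D_def)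
  have R_eq: "R (?W H) = (\<Prod>u\<in>d_subsets n 2. \<rho> ^ ?W H u * (1-\<rho>))" if "H \<subseteq> D" for H
    unfolding R_def using \<rho> that
    by (subst pmf_Pi') (auto simp: finite_d_subsets D_def intro: weighted_proj_eq_0)
  have Q_eq: "Q w H = (\<Prod>e\<in>D. if e \<in> H then s w e else 1 - s w e)" if "H \<subseteq> D" for w H
    unfolding Q_def by (rule pmf_random_subset) (use finD that s01 in auto)
  have factor_pos: "0 < (if e \<in> H then s (?W H) e else 1 - s (?W H) e)" if "H \<subseteq> D" for H e
    using HC[OF that] \<tau> by (auto simp: s_def)
  have Q_pos: "0 < Q (?W H) H" if "H \<subseteq> D" for H
    unfolding Q_eq[OF that] using factor_pos[OF that] by (intro prod_pos) auto
  have R_pos: "0 < R (?W H)" if "H \<subseteq> D" for H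
    unfolding R_eq[OF that] using \<rho> by (intro prod_pos) auto
  have m_pos: "0 < m H" if "H \<subseteq> D" for H
    unfolding m_def using Q_pos[OF that] R_pos[OF that] by simp
  have "(\<Sum>H\<in>set_pmf P. m H) \<le> (\<Sum>H\<in>Pow D. m H)"
    by (intro sum_mono2) (use subP m_pos finD in \<open>auto intro: less_imp_le\<close>)
  \<comment> \<open>Group the hypergraphs by projection: for fixed \<open>w\<close> the factor
    \<open>Q w\<close> is a single probability mass function, and so is \<open>R\<close> over the
    projections.\<close>
  also have "\<dots> = (\<Sum>w\<in>?W ` Pow D. \<Sum>H\<in>{H \<in> Pow D. ?W H = w}. m H)"
    by (rule sum.image_gen) (simp add: finD)
  also have "\<dots> = (\<Sum>w\<in>?W ` Pow D. R w * (\<Sum>H\<in>{H \<in> Pow D. ?W H = w}. Q w H))"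
    unfolding sum_distrib_left m_def by (intro sum.cong refl) auto
  also have "\<dots> \<le> (\<Sum>w\<in>?W ` Pow D. R w * 1)"
    unfolding Q_def R_def by (intro sum_mono mult_left_mono sum_pmf_le_1) (auto simp: finD)
  also have "\<dots> \<le> 1"
    unfolding R_def using finD by (simp add: sum_pmf_le_1)
  finally have sum_m: "(\<Sum>H\<in>set_pmf P. m H) \<le> 1" .

  have int: "integrable (measure_pmf P) f" for f :: "nat set set \<Rightarrow> real"
    by (rule integrable_measure_pmf_finite[OF finP])
  have E_mono: "E f \<le> E g" if "\<And>H. H \<subseteq> D \<Longrightarrow> f H \<le> g H" for f g
    unfolding E_def P_def[symmetric]
    by (intro integral_mono_AE int AE_pmfI) (use subP that in auto)

  \<comment> \<open>The factor for absent edges is at most 1 and is dropped, which only lowers the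
    entropy bound.\<close>
  have ln_P: "ln (pmf P H) \<le> real (card H) * ln p" if "H \<subseteq> D" for H
  proof -
    have "pmf P H = (\<Prod>e\<in>D. if e \<in> H then p else 1 - p)"
      unfolding P using p by (subst pmf_random_subset[OF finD that]) auto
    also have "\<dots> = p ^ card H * (1-p) ^ card (D - H)"
      using finD that by (simp add: prod.If_cases Int_absorb1 Diff_eq)
    finally have eq: "pmf P H = p ^ card H * (1-p) ^ card (D - H)" .
    have "\<dots> \<le> p ^ card H * 1"
      using p by (intro mult_left_mono power_le_one) auto
    then have "ln (pmf P H) \<le> ln (p ^ card H)"
      unfolding eq using p by (subst ln_le_cancel_iff) auto
    then show ?thesis using p by (simp add: ln_realpow)
  qed

  have ln_R: "ln (R (?W H)) = real (card H) * (real (d choose 2) * ln \<rho>) + real (n choose 2) * ln (1-\<rho>)"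
    if "H \<subseteq> D" for H
  proof -
    have "ln (R (?W H)) = (\<Sum>u\<in>d_subsets n 2. ln (\<rho> ^ ?W H u * (1-\<rho>)))"
      unfolding R_eq[OF that] by (rule ln_prod[OF finite_d_subsets]) (use \<rho> in simp)
    also have "\<dots> = (\<Sum>u\<in>d_subsets n 2. real (?W H u) * ln \<rho> + ln (1-\<rho>))"
      using \<rho> by (intro sum.cong refl) (simp add: ln_mult ln_realpow)
    also have "\<dots> = real (\<Sum>u\<in>d_subsets n 2. ?W H u) * ln \<rho> + real (n choose 2) * ln (1-\<rho>)"
      by (simp add: sum.distrib sum_distrib_right card_d_subsets)
    finally show ?thesis
      unfolding sum_weighted_proj[OF that[unfolded D_def]] by (simp add: mult_ac)
  qed

  have ln_Q: "ln (Q (?W H) H) \<ge> - (ln 2 * real (card (B (?W H))) + ln (1/\<tau>) * real (card (H - B (?W H)))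
       + 2 * \<tau> * real (card (?C (?W H))))" if H: "H \<subseteq> D" for H
  proof -
    let ?w = "?W H"
    have \<tau>': "- (2 * \<tau>) \<le> ln (1 - \<tau>)"
      by (rule ln_one_minus_ge) (use \<tau> in auto)
    have card_eq: "real (card X) = (\<Sum>e\<in>D. of_bool (e \<in> X))" if "X \<subseteq> D" for X
      using finD that by (simp add: of_bool_def sum.If_cases Int_absorb1)
    have HB: "H - B ?w \<subseteq> D"
      using H by blast
    have "- (ln 2 * real (card (B ?w)) + ln (1/\<tau>) * real (card (H - B ?w)) + 2 * \<tau> * real (card (?C ?w)))
       = (\<Sum>e\<in>D. - (ln 2 * of_bool (e \<in> B ?w) + ln (1/\<tau>) * of_bool (e \<in> H - B ?w) + 2 * \<tau> * of_bool (e \<in> ?C ?w)))"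
      unfolding card_eq[OF BD[OF H]] card_eq[OF CD] card_eq[OF HB]
      by (simp only: sum_negf sum.distrib sum_distrib_left)
    \<comment> \<open>The comparison is made for each \<open>e\<close> separately; an element may be
      charged by several terms, which is harmless since each charge is nonnegative.\<close>
    also have "\<dots> \<le> (\<Sum>e\<in>D. ln (if e \<in> H then s ?w e else 1 - s ?w e))"
    proof (rule sum_mono)
      fix e assume "e \<in> D"
      have "ln (1/2 :: real) = - ln 2" "ln (1/\<tau>) = - ln \<tau>"
        using \<tau> by (simp_all add: ln_div)
      moreover have "0 < ln (2 :: real)" by simp
      moreover have "e \<in> H \<Longrightarrow> e \<in> ?C ?w"
        using HC[OF H] by blast
      ultimately show "- (ln 2 * of_bool (e \<in> B ?w) + ln (1/\<tau>) * of_bool (e \<in> H - B ?w) + 2 * \<tau> * of_bool (e \<in> ?C ?w))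
          \<le> ln (if e \<in> H then s ?w e else 1 - s ?w e)"
        using \<tau>(1) \<tau>' by (cases "e \<in> H"; cases "e \<in> B ?w"; cases "e \<in> ?C ?w") (simp_all add: s_def)
    qed
    also have "\<dots> = ln (Q ?w H)"
      unfolding Q_eq[OF H]
      by (rule ln_prod[symmetric, OF finD]) (rule factor_pos[OF H, THEN less_imp_neq, THEN not_sym])
    finally show ?thesis .
  qed

  have "E (\<lambda>H. real (card H) * (real (d choose 2) * ln \<rho>) + real (n choose 2) * ln (1-\<rho>)
      - (ln 2 * real (card (B (?W H))) + ln (1/\<tau>) * real (card (H - B (?W H)))
       + 2 * \<tau> * real (card (?C (?W H))))) \<le> E (\<lambda>H. ln (m H))"
  proof (rule E_mono)
    fix H assume H: "H \<subseteq> D"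
    show "real (card H) * (real (d choose 2) * ln \<rho>) + real (n choose 2) * ln (1-\<rho>)
      - (ln 2 * real (card (B (?W H))) + ln (1/\<tau>) * real (card (H - B (?W H)))
       + 2 * \<tau> * real (card (?C (?W H)))) \<le> ln (m H)"
      using ln_R[OF H] ln_Q[OF H] R_pos[OF H] Q_pos[OF H] by (simp add: m_def ln_mult)
  qed
  also have "\<dots> \<le> E (\<lambda>H. ln (pmf P H))"
    unfolding E_def P_def[symmetric]
    by (rule expectation_ln_le_expectation_ln_pmf[OF finP _ sum_m]) (use m_pos subP in auto)
  also have "\<dots> \<le> E (\<lambda>H. real (card H) * ln p)"
    by (rule E_mono) (rule ln_P)
  finally have main: "E (\<lambda>H. real (card H)) * (real (d choose 2) * ln \<rho>) + real (n choose 2) * ln (1-\<rho>)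
      - (ln 2 * E (\<lambda>H. real (card (B (?W H)))) + ln (1/\<tau>) * E (\<lambda>H. real (card (H - B (?W H))))
       + 2 * \<tau> * E (\<lambda>H. real (card (?C (?W H))))) \<le> E (\<lambda>H. real (card H)) * ln p"
    unfolding E_def P_def[symmetric] by (simp add: int)
  have "E (\<lambda>H. real (card H)) = p * real (n choose d)"
    unfolding E_def P_def[symmetric] P using p finD
    by (subst expectation_card_random_subset) (auto simp: D_def card_d_subsets)
  with main show ?thesis
    using p \<rho> by (simp add: ln_div algebra_simps)
qed

section \<open>The expected number of cliques\<close>

text \<open>Given the trace \<open>S\<close>, the hyperedge is determined by its part outside
  \<open>e\<close>, which has \<open>d - card S\<close> elements.\<close>

lemma card_hyperedges_meeting_in:
  assumes "card S \<le> d" "S \<subseteq> e" "finite S"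
  shows "card {h \<in> d_subsets n d. h \<inter> e = S} \<le> n ^ (d - card S)"
proof -
  have "inj_on (\<lambda>h. h - e) {h \<in> d_subsets n d. h \<inter> e = S}"
    by (rule inj_onI) blast
  moreover have "(\<lambda>h. h - e) ` {h \<in> d_subsets n d. h \<inter> e = S} \<subseteq> d_subsets n (d - card S)"
  proof (rule image_subsetI)
    fix h assume h: "h \<in> {h \<in> d_subsets n d. h \<inter> e = S}"
    then have "h - e = h - S" "S \<subseteq> h" by auto
    then show "h - e \<in> d_subsets n (d - card S)"
      using h assms(3) by (auto simp: d_subsets_def card_Diff_subset)
  qed
  ultimately have "card {h \<in> d_subsets n d. h \<inter> e = S} \<le> card (d_subsets n (d - card S))"
    by (rule card_inj_on_le) (rule finite_d_subsets)
  also have "\<dots> \<le> n ^ (d - card S)"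
    unfolding card_d_subsets by (cases "d - card S \<le> n") (simp_all add: binomial_le_pow binomial_eq_0)
  finally show ?thesis .
qed

text \<open>Each pair in \<open>e\<close> lies in a hyperedge and hence in its trace on
  \<open>e\<close>. Traces with fewer than two elements cover no pair; the trace \<open>e\<close>
  itself is allowed, for \<open>e\<close> may be a hyperedge.\<close>

lemma weighted_clique_cover:
  assumes H: "H \<subseteq> d_subsets n d" and e: "e \<in> weighted_cliques n d (weighted_proj H)"
  defines "F \<equiv> {S. \<exists>h\<in>H. S = h \<inter> e \<and> 2 \<le> card S}"
  shows "d choose 2 \<le> (\<Sum>S\<in>F. card S choose 2)"
proof -
  have e': "finite e" "card e = d"
    using e finite_subset by (auto simp: weighted_cliques_def d_subsets_def)
  have fin: "finite F"
    by (rule finite_subset[of _ "Pow e"]) (use e' in \<open>auto simp: F_def\<close>)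
  have finF: "finite S" if "S \<in> F" for S
    using that e' by (auto simp: F_def)
  have "{u. u \<subseteq> e \<and> card u = 2} \<subseteq> (\<Union>S\<in>F. {u. u \<subseteq> S \<and> card u = 2})"
  proof
    fix u assume "u \<in> {u. u \<subseteq> e \<and> card u = 2}"
    then have u: "u \<subseteq> e" "card u = 2" by auto
    then have "0 < card {h \<in> H. u \<subseteq> h}"
      using e by (simp add: weighted_cliques_def weighted_proj_def)
    then have "{h \<in> H. u \<subseteq> h} \<noteq> {}"
      by (metis card.empty less_irrefl)
    then obtain h where h: "h \<in> H" "u \<subseteq> h" by blast
    then have "2 \<le> card (h \<inter> e)"
      using u e' by (metis card_mono finite_Int le_inf_iff)
    then have "h \<inter> e \<in> F"
      using h by (auto simp: F_def)
    then show "u \<in> (\<Union>S\<in>F. {u. u \<subseteq> S \<and> card u = 2})"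
      using u h by (intro UN_I[of "h \<inter> e"]) auto
  qed
  then have "card {u. u \<subseteq> e \<and> card u = 2} \<le> card (\<Union>S\<in>F. {u. u \<subseteq> S \<and> card u = 2})"
    by (rule card_mono[rotated]) (use fin finF in auto)
  also have "\<dots> \<le> (\<Sum>S\<in>F. card {u. u \<subseteq> S \<and> card u = 2})"
    by (rule card_UN_le[OF fin])
  also have "\<dots> = (\<Sum>S\<in>F. card S choose 2)"
    by (intro sum.cong refl n_subsets finF)
  finally show ?thesis
    using n_subsets[OF e'(1), of 2] e'(2) by simp
qed

text \<open>A union bound over the families of traces that can cover \<open>e\<close>. Distinct
  traces come from distinct hyperedges, so expectations factorise. The hypothesis \<open>le\<close>
  prices a trace at no more, up to \<open>K\<close>, than its pairs at \<open>x\<close>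
  each.\<close>

lemma expectation_weighted_clique_le:
  fixes p K x :: real
  assumes p: "0 \<le> p" "p \<le> 1" and x: "0 \<le> x" "x \<le> 1" and K: "1 \<le> K"
    and e: "e \<in> d_subsets n d"
    and le: "\<And>S. S \<subseteq> e \<Longrightarrow> 2 \<le> card S \<Longrightarrow>
      p * real (card {h \<in> d_subsets n d. h \<inter> e = S}) \<le> K * x ^ (card S choose 2)"
  shows "measure_pmf.expectation (random_hypergraph n d p)
           (\<lambda>H. of_bool (e \<in> weighted_cliques n d (weighted_proj H)))
         \<le> 2 ^ (2 ^ d) * K ^ (2 ^ d) * x ^ (d choose 2)"
proof -
  define A where "A S = {h \<in> d_subsets n d. h \<inter> e = S}" for S
  define FF where "FF = {F \<in> Pow {S \<in> Pow e. 2 \<le> card S}. d choose 2 \<le> (\<Sum>S\<in>F. card S choose 2)}"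
  let ?E = "measure_pmf.expectation (random_hypergraph n d p)"
  have e': "finite e" "card e = d"
    using e finite_subset by (auto simp: d_subsets_def)
  have FF_sub: "FF \<subseteq> Pow (Pow e)"
    by (auto simp: FF_def)
  then have finFF: "finite FF"
    by (rule finite_subset) (simp add: e')
  have card_FF: "card FF \<le> 2 ^ (2 ^ d)"
    using card_mono[OF _ FF_sub] e' by (simp add: card_Pow)
  have F: "finite F" "card F \<le> 2 ^ d" if "F \<in> FF" for F
  proof -
    have "F \<subseteq> Pow e" using FF_sub that by blast
    then show "finite F" "card F \<le> 2 ^ d"
      using e' finite_subset card_mono[of "Pow e" F] by (auto simp: card_Pow)
  qed
  note int = integrable_random_subset[OF finite_d_subsets]
  have "?E (\<lambda>H. of_bool (e \<in> weighted_cliques n d (weighted_proj H)))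
      \<le> ?E (\<lambda>H. \<Sum>F\<in>FF. \<Prod>S\<in>F. real (card (H \<inter> A S)))"
    unfolding random_hypergraph_eq_random_subset
  proof (intro integral_mono_AE int AE_pmfI)
    fix H assume "H \<in> set_pmf (random_subset (d_subsets n d) (\<lambda>_. p))"
    then have H: "H \<subseteq> d_subsets n d"
      using set_pmf_random_subset by blast
    show "of_bool (e \<in> weighted_cliques n d (weighted_proj H))
        \<le> (\<Sum>F\<in>FF. \<Prod>S\<in>F. real (card (H \<inter> A S)))"
    proof (cases "e \<in> weighted_cliques n d (weighted_proj H)")
      case True
      \<comment> \<open>The family of traces that actually occur: its product consists of positive
        integers, so this one summand already dominates the indicator.\<close>
      define F0 where "F0 = {S. \<exists>h\<in>H. S = h \<inter> e \<and> 2 \<le> card S}"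
      have F0: "F0 \<in> FF"
        using weighted_clique_cover[OF H True] by (auto simp: FF_def F0_def)
      have finH: "finite H"
        using H finite_d_subsets finite_subset by blast
      have "1 \<le> card (H \<inter> A S)" if "S \<in> F0" for S
      proof -
        from that obtain h where "h \<in> H \<inter> A S"
          using H by (auto simp: F0_def A_def)
        then show ?thesis
          using finH by (metis Suc_leI One_nat_def card_gt_0_iff empty_iff finite_Int)
      qed
      then have "1 \<le> (\<Prod>S\<in>F0. real (card (H \<inter> A S)))"
        by (intro prod_ge_1) fastforce
      also have "\<dots> \<le> (\<Sum>F\<in>FF. \<Prod>S\<in>F. real (card (H \<inter> A S)))"
        by (rule member_le_sum[OF F0 _ finFF]) (auto intro: prod_nonneg)
      finally show ?thesis using True by simp
    qed (auto intro!: sum_nonneg prod_nonneg)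
  qed
  also have "\<dots> = (\<Sum>F\<in>FF. ?E (\<lambda>H. \<Prod>S\<in>F. real (card (H \<inter> A S))))"
    unfolding random_hypergraph_eq_random_subset by (intro Bochner_Integration.integral_sum int)
  also have "\<dots> = (\<Sum>F\<in>FF. \<Prod>S\<in>F. p * real (card (A S)))"
    unfolding random_hypergraph_eq_random_subset using p F
    by (intro sum.cong refl expectation_random_subset_prod_card finite_d_subsets)
      (auto simp: A_def disjoint_family_on_def)
  also have "\<dots> \<le> (\<Sum>F\<in>FF. K ^ (2 ^ d) * x ^ (d choose 2))"
  proof (rule sum_mono)
    fix F assume FFF: "F \<in> FF"
    have "(\<Prod>S\<in>F. p * real (card (A S))) \<le> (\<Prod>S\<in>F. K * x ^ (card S choose 2))"
      using FFF p le by (intro prod_mono) (auto simp: FF_def A_def)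
    also have "\<dots> = K ^ card F * x ^ (\<Sum>S\<in>F. card S choose 2)"
      by (simp add: prod.distrib power_sum)
    \<comment> \<open>The exponent of \<open>K \<ge> 1\<close> grows to the largest possible family
      size, and that of \<open>x \<le> 1\<close> shrinks to the number of pairs to be
      covered.\<close>
    also have "\<dots> \<le> K ^ (2 ^ d) * x ^ (d choose 2)"
      using K x F(2)[OF FFF] FFF
      by (intro mult_mono power_increasing power_decreasing) (auto simp: FF_def)
    finally show "(\<Prod>S\<in>F. p * real (card (A S))) \<le> K ^ (2 ^ d) * x ^ (d choose 2)" .
  qed
  also have "\<dots> = real (card FF) * (K ^ (2 ^ d) * x ^ (d choose 2))"
    by simp
  also have "\<dots> \<le> 2 ^ (2 ^ d) * (K ^ (2 ^ d) * x ^ (d choose 2))"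
    using card_FF K x by (intro mult_right_mono) (auto simp flip: of_nat_le_iff)
  finally show ?thesis by (simp add: mult_ac)
qed

lemma expectation_card_weighted_cliques_le:
  fixes p q :: real
  assumes "\<And>e. e \<in> d_subsets n d \<Longrightarrow> measure_pmf.expectation (random_hypergraph n d p)
           (\<lambda>H. of_bool (e \<in> weighted_cliques n d (weighted_proj H))) \<le> q"
  shows "measure_pmf.expectation (random_hypergraph n d p)
           (\<lambda>H. real (card (weighted_cliques n d (weighted_proj H)))) \<le> real (n choose d) * q"
proof -
  let ?E = "measure_pmf.expectation (random_hypergraph n d p)"
  have "weighted_cliques n d w \<subseteq> d_subsets n d" for w
    by (auto simp: weighted_cliques_def)
  then have "real (card (weighted_cliques n d w)) = (\<Sum>e\<in>d_subsets n d. of_bool (e \<in> weighted_cliques n d w))" for w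
    by (simp add: of_bool_def sum.If_cases finite_d_subsets Int_absorb1)
  then have "?E (\<lambda>H. real (card (weighted_cliques n d (weighted_proj H))))
     = (\<Sum>e\<in>d_subsets n d. ?E (\<lambda>H. of_bool (e \<in> weighted_cliques n d (weighted_proj H))))"
    unfolding random_hypergraph_eq_random_subset
    by (simp only: Bochner_Integration.integral_sum[OF integrable_random_subset[OF finite_d_subsets]])
  also have "\<dots> \<le> (\<Sum>e\<in>d_subsets n d. q)"
    by (rule sum_mono) (rule assms)
  finally show ?thesis by (simp add: card_d_subsets)
qed

section \<open>Bounds on the loss for general parameters\<close>

lemma real_choose_two: "real (k choose 2) = real k * (real k - 1) / 2"
  by (induction k) (simp_all add: numeral_2_eq_2 field_simps)

text \<open>The estimator that always answers \<open>{}\<close> errs exactly on \<open>H\<close>,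
  whose expected size is the normalising denominator.\<close>

lemma weighted_partial_recovery_loss_le_1:
  assumes p: "0 < p" "p \<le> 1" and "d \<le> n"
  shows "weighted_partial_recovery_loss n d p \<le> 1"
proof -
  let ?E = "measure_pmf.expectation (random_hypergraph n d p)"
  define B :: "(nat set \<Rightarrow> nat) \<Rightarrow> nat set set" where "B = (\<lambda>w\<in>weighted_projections n d. {})"
  have B: "B \<in> estimators n d"
    by (simp add: B_def estimators_def)
  have "?E (\<lambda>H. real (card (sym_diff (B (weighted_proj H)) H))) = ?E (\<lambda>H. real (card H))"
    unfolding random_hypergraph_eq_random_subset
    by (intro integral_cong_AE AE_pmfI)
      (use set_pmf_random_subset[of "d_subsets n d" "\<lambda>_. p"] in \<open>auto simp: B_def weighted_projections_def\<close>)
  also have "\<dots> = p * real (n choose d)"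
    unfolding random_hypergraph_eq_random_subset
    by (subst expectation_card_random_subset) (use p in \<open>auto simp: finite_d_subsets card_d_subsets\<close>)
  finally have "?E (\<lambda>H. real (card (sym_diff (B (weighted_proj H)) H))) / (p * real (n choose d)) = 1"
    using assms by simp
  then show ?thesis
    unfolding weighted_partial_recovery_loss_def
    by (intro Min_le_iff[THEN iffD2] bexI[OF _ imageI[OF B]])
      (auto simp: finite_estimators estimators_nonempty)
qed

text \<open>Applies \<open>information_bound\<close> to an optimal estimator. Missed hyperedges lie
  in the symmetric difference, and the estimate lies in its union with \<open>H\<close>, so its
  expected size is at most \<open>L * m + m\<close>, hence at most \<open>2 * m\<close>.\<close>

lemma information_bound_loss:
  fixes n d :: nat and p \<rho> \<tau> :: real
  assumes p: "0 < p" "p < 1" and \<rho>: "0 < \<rho>" "\<rho> < 1" and \<tau>: "0 < \<tau>" "\<tau> \<le> 1/2" and "d \<le> n"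
  defines "m \<equiv> p * real (n choose d)"
  shows "m * ln (1/p)
     \<le> real (n choose 2) * ln (1/(1-\<rho>)) + real (d choose 2) * ln (1/\<rho>) * m + 2 * ln 2 * m
       + ln (1/\<tau>) * (weighted_partial_recovery_loss n d p * m)
       + 2 * \<tau> * measure_pmf.expectation (random_hypergraph n d p)
           (\<lambda>H. real (card (weighted_cliques n d (weighted_proj H))))"
proof -
  let ?E = "measure_pmf.expectation (random_hypergraph n d p)"
  define L where "L = weighted_partial_recovery_loss n d p"
  have m: "0 < m" using assms by (simp add: m_def)
  have "L \<in> (\<lambda>B. ?E (\<lambda>H. real (card (sym_diff (B (weighted_proj H)) H))) / m) ` estimators n d"
    unfolding L_def weighted_partial_recovery_loss_def m_def
    by (rule Min_in) (auto simp: finite_estimators estimators_nonempty)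
  then obtain B where B: "B \<in> estimators n d"
    and "L = ?E (\<lambda>H. real (card (sym_diff (B (weighted_proj H)) H))) / m"
    by blast
  then have EL: "?E (\<lambda>H. real (card (sym_diff (B (weighted_proj H)) H))) = L * m"
    using m by simp
  have L1: "L \<le> 1"
    unfolding L_def using weighted_partial_recovery_loss_le_1 assms by simp
  note int = integrable_random_subset[OF finite_d_subsets]
  have EH: "?E (\<lambda>H. real (card H)) = m"
    unfolding random_hypergraph_eq_random_subset m_def
    by (subst expectation_card_random_subset) (use p in \<open>auto simp: finite_d_subsets card_d_subsets\<close>)
  have fin: "finite H" "finite (B (weighted_proj H))"
    if "H \<in> set_pmf (random_subset (d_subsets n d) (\<lambda>_. p))" for H
  proof -
    have H: "H \<subseteq> d_subsets n d"
      using set_pmf_random_subset that by blast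
    then show "finite H"
      using finite_d_subsets finite_subset by blast
    have "B (weighted_proj H) \<subseteq> d_subsets n d"
      using B H by (auto simp: estimators_def weighted_projections_def)
    then show "finite (B (weighted_proj H))"
      using finite_d_subsets finite_subset by blast
  qed
  have "?E (\<lambda>H. real (card (H - B (weighted_proj H))))
      \<le> ?E (\<lambda>H. real (card (sym_diff (B (weighted_proj H)) H)))"
    unfolding random_hypergraph_eq_random_subset
    by (intro integral_mono_AE int AE_pmfI of_nat_mono card_mono) (use fin in auto)
  then have E1: "?E (\<lambda>H. real (card (H - B (weighted_proj H)))) \<le> L * m"
    by (simp add: EL)
  have "?E (\<lambda>H. real (card (B (weighted_proj H))))
      \<le> ?E (\<lambda>H. real (card (sym_diff (B (weighted_proj H)) H)) + real (card H))"
    unfolding random_hypergraph_eq_random_subset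
  proof (intro integral_mono_AE int AE_pmfI)
    fix H assume H: "H \<in> set_pmf (random_subset (d_subsets n d) (\<lambda>_. p))"
    have "card (B (weighted_proj H)) \<le> card (sym_diff (B (weighted_proj H)) H \<union> H)"
      by (rule card_mono) (use fin[OF H] in auto)
    also have "\<dots> \<le> card (sym_diff (B (weighted_proj H)) H) + card H"
      by (rule card_Un_le)
    finally show "real (card (B (weighted_proj H)))
        \<le> real (card (sym_diff (B (weighted_proj H)) H)) + real (card H)"
      by simp
  qed
  also have "\<dots> = ?E (\<lambda>H. real (card (sym_diff (B (weighted_proj H)) H))) + ?E (\<lambda>H. real (card H))"
    unfolding random_hypergraph_eq_random_subset by (intro Bochner_Integration.integral_add int)
  also have "\<dots> = L * m + m"
    by (simp only: EL EH)
  also have "\<dots> \<le> 2 * m"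
    using L1 m mult_right_mono[of L 1 m] by simp
  finally have E2: "?E (\<lambda>H. real (card (B (weighted_proj H)))) \<le> 2 * m" .
  have "ln 2 * ?E (\<lambda>H. real (card (B (weighted_proj H)))) \<le> ln 2 * (2 * m)"
    by (rule mult_left_mono[OF E2]) simp
  moreover have "ln (1/\<tau>) * ?E (\<lambda>H. real (card (H - B (weighted_proj H)))) \<le> ln (1/\<tau>) * (L * m)"
    by (rule mult_left_mono[OF E1]) (use \<tau> in simp)
  ultimately show ?thesis
    using information_bound[OF p \<rho> \<tau> B] unfolding L_def[symmetric] m_def[symmetric] by linarith
qed

section \<open>The loss above the threshold\<close>

text \<open>The exponent factors as \<open>(d - 2) * (1 - (1 - \<delta>) * (d + 1) / 2)\<close>,
  whose second factor changes sign at the threshold.\<close>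

lemma clique_exponent_pos:
  fixes d :: nat and \<delta> :: real
  assumes "3 \<le> d" "(real d - 1) / (real d + 1) < \<delta>"
  shows "0 < real d - 1 - \<delta> - real (d choose 2) * (1 - \<delta>)"
proof -
  have "(1 - \<delta>) * (real d + 1) < 2"
    using assms by (simp add: field_simps)
  then have "0 < (real d - 2) * (1 - (1 - \<delta>) * (real d + 1) / 2)"
    using assms by (intro mult_pos_pos) auto
  also have "\<dots> = real d - 1 - \<delta> - real (d choose 2) * (1 - \<delta>)"
    by (simp add: real_choose_two field_simps)
  finally show ?thesis .
qed

text \<open>After division by \<open>m\<close>, the terms of order \<open>ln n\<close> in
  \<open>information_bound_loss\<close> combine to \<open>\<eta> * ln n * (1 - L)\<close>; all
  others are bounded by constants, collected in the numerator.\<close>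

lemma weighted_partial_recovery_loss_ge:
  fixes d n :: nat and c \<delta> p \<eta> :: real
  assumes d: "3 \<le> d" and c: "0 < c" and \<delta>: "(real d - 1) / (real d + 1) < \<delta>" "\<delta> < 1"
    and n: "d \<le> n" and p: "p < 1"
    and pl: "c / 2 * real n powr (- real d + 1 + \<delta>) \<le> p"
    and pu: "p \<le> 2 * c * real n powr (- real d + 1 + \<delta>)"
  defines "\<eta> \<equiv> real d - 1 - \<delta> - real (d choose 2) * (1 - \<delta>)"
  defines "K \<equiv> 2 ^ (2 ^ d) * (max 1 (2 * c)) ^ (2 ^ d)"
  assumes \<rho>: "real n powr (\<delta> - 1) \<le> 1/2" and \<tau>: "real n powr - \<eta> \<le> 1/2"
  shows "1 - (4 * real d ^ d / c + 2 * ln 2 + 4 * K / c + ln (2 * c)) / (\<eta> * ln (real n))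
           \<le> weighted_partial_recovery_loss n d p"
proof -
  have \<delta>': "(1 - \<delta>) * (real d + 1) < 2"
    using \<delta> by (simp add: field_simps)
  have \<eta>: "0 < \<eta>"
    unfolding \<eta>_def using d \<delta>(1) by (rule clique_exponent_pos)
  have n0: "0 < real n" "1 < real n" using d n by auto
  have p0: "0 < p"
    using pl c n0 by (smt (verit) powr_gt_zero mult_pos_pos half_gt_zero)
  define L where "L = weighted_partial_recovery_loss n d p"
  define m where "m = p * real (n choose d)"
  \<comment> \<open>\<open>r\<close> has the order of the expected weight of a pair, and
    \<open>t\<close> is chosen so that \<open>t * r ^ (d choose 2)\<close> has the order of
    \<open>p\<close>.\<close>
  define r where "r = real n powr (\<delta> - 1)"
  define t where "t = real n powr - \<eta>"
  have m: "0 < m" using p0 n by (simp add: m_def)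
  have r: "0 < r" "r \<le> 1/2" and t: "0 < t" "t \<le> 1/2"
    using n0 \<rho> \<tau> by (auto simp: r_def t_def)
  have ln_r: "ln (1/r) = (1 - \<delta>) * ln n" and ln_t: "ln (1/t) = \<eta> * ln n"
    using n0 by (simp_all add: r_def t_def ln_div ln_powr algebra_simps)
  have powr_r: "r ^ k = real n powr ((\<delta> - 1) * real k)" for k
    using n0 by (simp add: r_def powr_powr flip: powr_realpow)

  \<comment> \<open>The expected number of hyperedges \<open>m\<close> is at least of order
    \<open>n powr (1 + \<delta>)\<close>, by \<open>(n / d) ^ d \<le> n choose d\<close>.\<close>
  have "real n powr (1 + \<delta>) = real n powr (- real d + 1 + \<delta>) * real n ^ d"
    using n0 by (simp add: powr_add[symmetric] flip: powr_realpow)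
  also have "c / 2 / real d ^ d * \<dots> = c / 2 * real n powr (- real d + 1 + \<delta>) * (real n / real d) ^ d"
    by (simp add: power_divide)
  also have "\<dots> \<le> m"
    unfolding m_def using binomial_ge_n_over_k_pow_k[OF n, where ?'a = real] pl c p0
    by (intro mult_mono) auto
  finally have m_ge: "real n powr (1 + \<delta>) \<le> 2 * real d ^ d / c * m"
    using c d by (simp add: field_simps)

  have "real (n choose 2) * ln (1/(1-r)) \<le> real n ^ 2 * (2 * r)"
  proof (rule mult_mono)
    show "real (n choose 2) \<le> real n ^ 2"
      using binomial_le_pow[of 2 n] n d by (simp flip: of_nat_power)
    show "ln (1/(1-r)) \<le> 2 * r"
      using ln_one_minus_ge[of r] r by (simp add: ln_div)
  qed (use r in auto)
  also have "\<dots> = 2 * (real n powr 2 * real n powr (\<delta> - 1))"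
    using n0 by (simp add: r_def)
  also have "\<dots> = 2 * real n powr (1 + \<delta>)"
    unfolding powr_add[symmetric] by (simp add: add.commute)
  also have "\<dots> \<le> 4 * real d ^ d / c * m"
    using m_ge by simp
  finally have T1: "real (n choose 2) * ln (1/(1-r)) \<le> 4 * real d ^ d / c * m" .

  have clique: "measure_pmf.expectation (random_hypergraph n d p)
       (\<lambda>H. of_bool (e \<in> weighted_cliques n d (weighted_proj H))) \<le> K * r ^ (d choose 2)"
    if e: "e \<in> d_subsets n d" for e
    unfolding K_def
  proof (rule expectation_weighted_clique_le[OF _ _ _ _ _ e])
    fix S assume S: "S \<subseteq> e" "2 \<le> card S"
    define k where "k = card S"
    have e': "finite e" "card e = d"
      using e finite_subset by (auto simp: d_subsets_def)
    then have k: "2 \<le> k" "k \<le> d"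
      using S card_mono by (auto simp: k_def)
    have "(1 - \<delta>) * (real k + 1) \<le> (1 - \<delta>) * (real d + 1)"
      using k \<delta> by (intro mult_left_mono) auto
    \<comment> \<open>Half this product is the gap in \<open>exponent\<close>: a trace of size
      \<open>k\<close> is no cheaper than its pairs taken singly, with equality at
      \<open>k = 2\<close>. The second factor is smallest at \<open>k = d\<close>, where it is the
      threshold condition.\<close>
    then have "0 \<le> (real k - 2) * (2 - (1 - \<delta>) * (real k + 1))"
      using k \<delta>' by (intro mult_nonneg_nonneg) auto
    then have exponent: "1 + \<delta> - real k \<le> (\<delta> - 1) * real (k choose 2)"
      by (simp add: real_choose_two field_simps)
    have "card {h \<in> d_subsets n d. h \<inter> e = S} \<le> n ^ (d - k)"
      unfolding k_def using S e' k finite_subset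
      by (intro card_hyperedges_meeting_in) (auto simp: k_def)
    then have "real (card {h \<in> d_subsets n d. h \<inter> e = S}) \<le> real n ^ (d - k)"
      by (metis of_nat_le_iff of_nat_power)
    then have "p * real (card {h \<in> d_subsets n d. h \<inter> e = S})
        \<le> 2 * c * real n powr (- real d + 1 + \<delta>) * real n ^ (d - k)"
      using pu p0 c by (intro mult_mono) auto
    also have "\<dots> = 2 * c * real n powr (1 + \<delta> - real k)"
      using n0 k by (simp add: powr_add[symmetric] of_nat_diff add_diff_eq flip: powr_realpow)
    also have "\<dots> \<le> max 1 (2 * c) * r ^ (k choose 2)"
      unfolding powr_r using exponent n0 c by (intro mult_mono powr_mono) auto
    finally show "p * real (card {h \<in> d_subsets n d. h \<inter> e = S})
        \<le> max 1 (2 * c) * r ^ (card S choose 2)"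
      by (simp add: k_def)
  qed (use p p0 r in auto)
  have "K > 0" by (simp add: K_def)
  have "2 * t * measure_pmf.expectation (random_hypergraph n d p)
         (\<lambda>H. real (card (weighted_cliques n d (weighted_proj H))))
      \<le> 2 * t * (real (n choose d) * (K * r ^ (d choose 2)))"
    using t by (intro mult_left_mono expectation_card_weighted_cliques_le clique) auto
  also have "\<dots> = 2 * K * real (n choose d) * (t * r ^ (d choose 2))"
    by (simp add: mult_ac)
  \<comment> \<open>Here the value of \<open>\<eta>\<close> is used: the weighted clique count
    becomes \<open>O(m)\<close>.\<close>
  also have "t * r ^ (d choose 2) = real n powr (- real d + 1 + \<delta>)"
    unfolding powr_r t_def powr_add[symmetric] by (simp add: \<eta>_def algebra_simps)
  also have "2 * K * real (n choose d) * real n powr (- real d + 1 + \<delta>)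
      \<le> 2 * K * real (n choose d) * (2 / c * p)"
    using pl c \<open>K > 0\<close> by (intro mult_left_mono) (auto simp: field_simps)
  also have "\<dots> = 4 * K / c * m"
    by (simp add: m_def)
  finally have T2: "2 * t * measure_pmf.expectation (random_hypergraph n d p)
         (\<lambda>H. real (card (weighted_cliques n d (weighted_proj H)))) \<le> 4 * K / c * m" .

  have "ln p \<le> ln (2 * c * real n powr (- real d + 1 + \<delta>))"
    using pu p0 by (subst ln_le_cancel_iff) auto
  then have ln_p: "ln (1/p) \<ge> (real d - 1 - \<delta>) * ln n - ln (2 * c)"
    using n0 c p0 by (simp add: ln_mult ln_powr ln_div algebra_simps)
  have "m * ((real d - 1 - \<delta>) * ln n - ln (2 * c)) \<le> m * ln (1/p)"
    using ln_p m by (intro mult_left_mono) auto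
  also have "\<dots> \<le> real (n choose 2) * ln (1/(1-r)) + real (d choose 2) * ln (1/r) * m + 2 * ln 2 * m
       + ln (1/t) * (L * m)
       + 2 * t * measure_pmf.expectation (random_hypergraph n d p)
           (\<lambda>H. real (card (weighted_cliques n d (weighted_proj H))))"
    unfolding m_def L_def using p0 p r t n by (intro information_bound_loss) auto
  also have "\<dots> \<le> 4 * real d ^ d / c * m + real (d choose 2) * ln (1/r) * m + 2 * ln 2 * m
       + ln (1/t) * (L * m) + 4 * K / c * m"
    using T1 T2 by simp
  also have "\<dots> = m * (4 * real d ^ d / c + real (d choose 2) * ln (1/r) + 2 * ln 2 + ln (1/t) * L + 4 * K / c)"
    by (simp add: algebra_simps)
  finally have "(real d - 1 - \<delta>) * ln n - ln (2 * c)
      \<le> 4 * real d ^ d / c + real (d choose 2) * ln (1/r) + 2 * ln 2 + ln (1/t) * L + 4 * K / c"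
    using m by simp
  then have "\<eta> * ln n * (1 - L) \<le> 4 * real d ^ d / c + 2 * ln 2 + 4 * K / c + ln (2 * c)"
    unfolding ln_r ln_t by (simp add: \<eta>_def algebra_simps)
  then have "1 - L \<le> (4 * real d ^ d / c + 2 * ln 2 + 4 * K / c + ln (2 * c)) / (\<eta> * ln n)"
    using \<eta> n0 by (subst pos_le_divide_eq) (auto simp: mult.commute)
  then show "1 - (4 * real d ^ d / c + 2 * ln 2 + 4 * K / c + ln (2 * c)) / (\<eta> * ln (real n))
           \<le> weighted_partial_recovery_loss n d p"
    by (simp add: L_def)
qed

theorem theorem18:
  fixes d :: nat and c \<delta> :: real and p :: "nat \<Rightarrow> real"
  assumes "d \<ge> 3"
    and "c > 0"
    and "(real d - 1) / (real d + 1) < \<delta>" and "\<delta> < 1"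
    and "(\<lambda>n. p n / real n powr (- real d + 1 + \<delta>)) \<longlonglongrightarrow> c"
  shows "(\<lambda>n. weighted_partial_recovery_loss n d (p n)) \<longlonglongrightarrow> 1"
proof -
  define \<eta> where "\<eta> = real d - 1 - \<delta> - real (d choose 2) * (1 - \<delta>)"
  \<comment> \<open>The whole numerator of the lower bound, with the clique constant as one of its
    terms.\<close>
  define K where "K = 4 * real d ^ d / c + 2 * ln 2 + 4 * (2 ^ (2 ^ d) * (max 1 (2 * c)) ^ (2 ^ d)) / c + ln (2 * c)"
  have \<eta>: "0 < \<eta>"
    unfolding \<eta>_def using assms(1,3) by (rule clique_exponent_pos)
  have "\<forall>\<^sub>F n in sequentially. c / 2 < p n / real n powr (- real d + 1 + \<delta>)"
    by (rule order_tendstoD[OF assms(5)]) (use assms(2) in simp)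
  moreover have "\<forall>\<^sub>F n in sequentially. p n / real n powr (- real d + 1 + \<delta>) < 2 * c"
    by (rule order_tendstoD[OF assms(5)]) (use assms(2) in simp)
  moreover have "\<forall>\<^sub>F n in sequentially. max d 1 \<le> n"
    by (rule eventually_ge_at_top)
  moreover have "\<forall>\<^sub>F n in sequentially. 2 * c * real n powr (- real d + 1 + \<delta>) < 1"
  proof -
    have "- real d + 1 + \<delta> < 0" using assms by simp
    then have "(\<lambda>n. 2 * c * real n powr (- real d + 1 + \<delta>)) \<longlonglongrightarrow> 0"
      by real_asymp
    then show ?thesis by (rule order_tendstoD) simp
  qed
  moreover have "\<forall>\<^sub>F n in sequentially. real n powr (\<delta> - 1) < 1/2"
  proof -
    have "(\<lambda>n. real n powr (\<delta> - 1)) \<longlonglongrightarrow> 0"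
      using assms(4) by real_asymp
    then show ?thesis by (rule order_tendstoD) simp
  qed
  moreover have "\<forall>\<^sub>F n in sequentially. real n powr (- \<eta>) < 1/2"
  proof -
    have "(\<lambda>n. real n powr (- \<eta>)) \<longlonglongrightarrow> 0"
      using \<eta> by real_asymp
    then show ?thesis by (rule order_tendstoD) simp
  qed
  \<comment> \<open>The limit is squeezed between a bound with error of order
    \<open>1 / ln n\<close> and the trivial estimator.\<close>
  ultimately have "\<forall>\<^sub>F n in sequentially. 1 - K / (\<eta> * ln (real n)) \<le> weighted_partial_recovery_loss n d (p n)
      \<and> weighted_partial_recovery_loss n d (p n) \<le> 1"
  proof eventually_elim
    case (elim n)
    define x where "x = real n powr (- real d + 1 + \<delta>)"
    have x: "0 < x" using elim by (simp add: x_def)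
    have pl: "c / 2 * x \<le> p n" and pu: "p n \<le> 2 * c * x"
      using elim x unfolding x_def[symmetric] by (simp_all add: field_simps)
    have p1: "p n < 1"
      using pu elim unfolding x_def[symmetric] by simp
    have p0: "0 < p n"
      using pl x assms(2) by (smt (verit) mult_pos_pos half_gt_zero)
    show ?case
    proof
      show "1 - K / (\<eta> * ln (real n)) \<le> weighted_partial_recovery_loss n d (p n)"
        unfolding K_def \<eta>_def
        by (rule weighted_partial_recovery_loss_ge[OF assms(1-4) _ p1 pl[unfolded x_def] pu[unfolded x_def]])
          (use elim in \<open>auto simp: \<eta>_def\<close>)
      show "weighted_partial_recovery_loss n d (p n) \<le> 1"
        by (rule weighted_partial_recovery_loss_le_1) (use p0 p1 elim in auto)
    qed
  qed
  then have "\<forall>\<^sub>F n in sequentially. 1 - K / (\<eta> * ln (real n)) \<le> weighted_partial_recovery_loss n d (p n)"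
    and "\<forall>\<^sub>F n in sequentially. weighted_partial_recovery_loss n d (p n) \<le> 1"
    by (auto elim: eventually_mono)
  moreover have "(\<lambda>n. 1 - K / (\<eta> * ln (real n))) \<longlonglongrightarrow> 1"
    using \<eta> by real_asymp
  ultimately show ?thesis
    by (rule tendsto_sandwich[OF _ _ _ tendsto_const])
qed

end
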